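(* For every positive integer $s$, as formal power series in $y$, \[ FL_{2}(s,y)=\frac{P_s(y)}{Q_s(y)} . \]
   Context: Definition of the counting function. The pseudo-line graph $L_{n,2}$ has $n$ vertices $v_1,\dots,v_n$ in a line, with edges joining consecutive vertices, one dangling (half-)edge at each of the two ends $v_1$ and $v_n$, and $2$ self-loops at each vertex. A magic labelling with magic sum $s$ assigns a nonnegative integer to each edge (including loops and dangling edges) so that at each vertex the labels of incident edges (each loop counted once) sum to $s$. Explicitly, for $n\ge 1$ and $s\in\mathbb{N}$, $h_{L_{n,2}}(s)$ is the number of nonnegative integer tuples $(\beta_1,\dots,\beta_{n+1};\alpha_{i,1},\alpha_{i,2}\ (1\le i\le n))$ with $\beta_i+\alpha_{i,1}+\alpha_{i,2}+\beta_{i+1}=s$ for all $1\le i\le n$; equivalently, it is the number of $(x_1,\dots,x_{2n+1})\in\mathbb{N}^{2n+1}$ with $x_{2i-1}+x_{2i}+x_{2i+1}\le s$ for $i=1,\dots,n$. By convention $h_{L_{0,2}}(s)=s+1$. Set \[ FL_2(s,y)=\sum_{n=0}^{\infty}h_{L_{n,2}}(s)\,y^n . \] Definition of the polynomials. For $n\ge 4$, \[ P_n(y)=-y[P_{n-1}(-y)+P_{n-3}(-y)]+2P_{n-2}(y)-P_{n-4}(y), \] \[ Q_n(y)=-y[Q_{n-1}(-y)+Q_{n-3}(-y)]+2Q_{n-2}(y)-Q_{n-4}(y), \] with initial values $P_0(y)=1$, $P_1(y)=2$, $P_2(y)=3-2y$, $P_3(y)=4-4y-2y^2$, and $Q_0(y)=1-y$,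 $Q_1(y)=1-2y-y^2$, $Q_2(y)=1-4y-2y^2+y^3$, $Q_3(y)=1-6y-7y^2+2y^3+y^4$. *)

theory Defs
  imports
    "HOL-Library.FuncSet"
    "HOL-Computational_Algebra.Polynomial_FPS"
begin

text \<open>
  For \<open>n \<ge> 1\<close>, the edges of the pseudo-line graph \<open>L\<^bsub>n,2\<^esub>\<close> are indexed as follows: \<open>\<beta> 1\<close> and
  \<open>\<beta> (n + 1)\<close> label the dangling edges at the two ends, \<open>\<beta> i\<close> for \<open>2 \<le> i \<le> n\<close> labels the edge
  between \<open>v\<^bsub>i-1\<^esub>\<close> and \<open>v\<^bsub>i\<^esub>\<close>, and \<open>\<alpha> (i, j)\<close> labels the \<open>j\<close>-th loop at \<open>v\<^bsub>i\<^esub>\<close>.  The extensional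
  function space makes two labellings equal iff they agree on all edges.
\<close>

definition magic_labellings :: "nat \<Rightarrow> nat \<Rightarrow> ((nat \<Rightarrow> nat) \<times> (nat \<times> nat \<Rightarrow> nat)) set" where
  "magic_labellings n s =
     {(\<beta>, \<alpha>). \<beta> \<in> {1..n + 1} \<rightarrow>\<^sub>E UNIV \<and> \<alpha> \<in> {1..n} \<times> {1, 2} \<rightarrow>\<^sub>E UNIV \<and>
        (\<forall>i\<in>{1..n}. \<beta> i + \<alpha> (i, 1) + \<alpha> (i, 2) + \<beta> (i + 1) = s)}"

text \<open>The value at \<open>n = 0\<close> is a convention: there the labelling set is infinite.\<close>

definition h_L2 :: "nat \<Rightarrow> nat \<Rightarrow> nat" where
  "h_L2 n s = (if n = 0 then s + 1 else card (magic_labellings n s))"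

lemma finite_magic_labellings:
  assumes "n \<ge> 1"
  shows "finite (magic_labellings n s)"
proof (rule finite_subset)
  let ?B = "({1..n + 1} \<rightarrow>\<^sub>E {..s}) \<times> ({1..n} \<times> {1, 2} \<rightarrow>\<^sub>E {..s})"
  show "finite ?B"
    by (intro finite_cartesian_product finite_PiE) auto
  show "magic_labellings n s \<subseteq> ?B"
  proof (rule subrelI)
    fix \<beta> :: "nat \<Rightarrow> nat" and \<alpha> :: "nat \<times> nat \<Rightarrow> nat"
    assume "(\<beta>, \<alpha>) \<in> magic_labellings n s"
    then have \<beta>: "\<beta> \<in> {1..n + 1} \<rightarrow>\<^sub>E UNIV" and \<alpha>: "\<alpha> \<in> {1..n} \<times> {1, 2} \<rightarrow>\<^sub>E UNIV"
      and eq: "\<And>i. i \<in> {1..n} \<Longrightarrow> \<beta> i + \<alpha> (i, 1) + \<alpha> (i, 2) + \<beta> (i + 1) = s"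
      unfolding magic_labellings_def by auto
    have "\<beta> i \<le> s" if "i \<in> {1..n + 1}" for i
    proof (cases "i = n + 1")
      case True
      then show ?thesis using eq[of n] assms by auto
    next
      case False
      then show ?thesis using eq[of i] that by auto
    qed
    then have "\<beta> \<in> {1..n + 1} \<rightarrow>\<^sub>E {..s}"
      using \<beta> by (auto simp: PiE_iff)
    moreover have "\<alpha> (i, j) \<le> s" if "i \<in> {1..n}" "j \<in> {1, 2}" for i j
      using eq[OF that(1)] that(2) by auto
    then have "\<alpha> \<in> {1..n} \<times> {1, 2} \<rightarrow>\<^sub>E {..s}"
      using \<alpha> by (auto simp: PiE_iff)
    ultimately show "(\<beta>, \<alpha>) \<in> ?B"
      by simp
  qed
qed

definition FL2 :: "nat \<Rightarrow> rat fps" where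
  "FL2 s = Abs_fps (\<lambda>n. of_nat (h_L2 n s))"

definition Y :: "rat poly" where
  "Y = [:0, 1:]"

abbreviation neg_arg :: "rat poly \<Rightarrow> rat poly" where
  "neg_arg p \<equiv> p \<circ>\<^sub>p (- Y)"

fun P :: "nat \<Rightarrow> rat poly" where
  "P 0 = 1"
| "P (Suc 0) = 2"
| "P (Suc (Suc 0)) = 3 - 2 * Y"
| "P (Suc (Suc (Suc 0))) = 4 - 4 * Y - 2 * Y ^ 2"
| "P (Suc (Suc (Suc (Suc n)))) =
     - Y * (neg_arg (P (n + 3)) + neg_arg (P (n + 1))) + 2 * P (n + 2) - P n"

fun Q :: "nat \<Rightarrow> rat poly" where
  "Q 0 = 1 - Y"
| "Q (Suc 0) = 1 - 2 * Y - Y ^ 2"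
| "Q (Suc (Suc 0)) = 1 - 4 * Y - 2 * Y ^ 2 + Y ^ 3"
| "Q (Suc (Suc (Suc 0))) = 1 - 6 * Y - 7 * Y ^ 2 + 2 * Y ^ 3 + Y ^ 4"
| "Q (Suc (Suc (Suc (Suc n)))) =
     - Y * (neg_arg (Q (n + 3)) + neg_arg (Q (n + 1))) + 2 * Q (n + 2) - Q n"

text \<open>
  The constant coefficient of \<open>Q n\<close> is \<open>1\<close>, so dividing by \<open>fps_of_poly (Q n)\<close> is multiplication by
  a genuine inverse of formal power series.
\<close>

lemma coeff_0_Q: "coeff (Q n) 0 = 1"
proof (induction n rule: Q.induct)
  case (5 n)
  then show ?case
    by (simp add: coeff_mult_0 Y_def numeral_poly)
qed (simp_all add: Y_def power2_eq_square power3_eq_cube power4_eq_xxxx coeff_mult_0 numeral_poly)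

end

theory Submission
  imports Defs
begin

text \<open>
  Let \<open>M\<close> be the transfer matrix with entries \<open>M i j = max 0 (s + 1 - i - j)\<close>, \<open>0 \<le> i, j \<le> s\<close>,
  so that \<open>FL2 s = 1\<^sup>T (I - y M)\<^sup>-\<^sup>1 1\<close> for the all-ones vector \<open>1\<close>.  Since \<open>M\<close> is symmetric, it suffices to find a polynomial
  vector \<open>v\<close> with \<open>(I - y M) v = 2 Q 1\<close> and \<open>1\<^sup>T v = 2 P\<close>.  Taking second differences turns
  the first equation into \<open>v (i + 1) - 2 v i + v (i - 1) = y v (s + 1 - i)\<close>; the parts of \<open>v\<close>
  that are symmetric and antisymmetric under \<open>i \<mapsto> s + 1 - i\<close> then satisfy
  Chebyshev recurrences with parameters \<open>2 + y\<close> and \<open>2 - y\<close>.  This gives \<open>v\<close>, and with it \<open>P\<close> and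
  \<open>Q\<close>, as bilinear expressions in two Chebyshev-like sequences taken at \<open>y\<close> and \<open>- y\<close>.
\<close>

subsection \<open>Two Chebyshev-like sequences\<close>

text \<open>
  If \<open>y = (q - 1/q)\<^sup>2\<close> then, up to factors depending only on the parity of \<open>n\<close>, these are
  \<open>q\<^sup>n + q\<^sup>-\<^sup>n\<close> and \<open>q\<^sup>n - q\<^sup>-\<^sup>n\<close>.
\<close>

fun cheb_sym :: "'a::comm_ring_1 \<Rightarrow> nat \<Rightarrow> 'a" and cheb_anti :: "'a \<Rightarrow> nat \<Rightarrow> 'a" where
  "cheb_sym y 0 = 2"
| "cheb_sym y (Suc 0) = 1"
| "cheb_sym y (Suc (Suc n)) = cheb_sym y n + y * cheb_anti y (Suc n)"
| "cheb_anti y 0 = 0"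
| "cheb_anti y (Suc 0) = 1"
| "cheb_anti y (Suc (Suc n)) = cheb_anti y n + cheb_sym y (Suc n)"

text \<open>Of the four values at \<open>n\<close> and \<open>n + 1\<close>, two are linear in the
  other two, in a way that depends on the parity of \<open>n\<close>. This reduces
  \<open>P_form_rec\<close> and \<open>Q_form_rec\<close> to polynomial identities in two values at
  \<open>y\<close> and two at \<open>- y\<close>.\<close>

lemma cheb_parity:
  fixes y :: "'a::comm_ring_1"
  shows "(even n \<longrightarrow> cheb_sym y n = 2 * cheb_sym y (Suc n) - y * cheb_anti y n \<and>
                     cheb_anti y (Suc n) = cheb_sym y (Suc n) + 2 * cheb_anti y n) \<and>
         (odd n \<longrightarrow> cheb_sym y (Suc n) = 2 * cheb_sym y n + y * cheb_anti y (Suc n) \<and>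
                    cheb_anti y n = 2 * cheb_anti y (Suc n) - cheb_sym y n)"
  by (induction n) (auto simp: algebra_simps)

text \<open>The closed form of \<open>2 * P n\<close>; it arises as the sum of the entries of the
  vector \<open>sol\<close> below.\<close>

definition P_form :: "'a::comm_ring_1 \<Rightarrow> nat \<Rightarrow> 'a" where
  "P_form y n = cheb_sym (- y) (n + 2) * cheb_anti y n + cheb_anti y (n + 2) * cheb_sym (- y) n"

text \<open>The closed form of \<open>2 * Q n\<close>; it is the common right-hand side of the
  system solved by \<open>sol\<close>.\<close>

definition Q_form :: "'a::comm_ring_1 \<Rightarrow> nat \<Rightarrow> 'a" where
  "Q_form y n = cheb_sym (- y) (n + 2) * cheb_sym y (n + 1)
     - y * cheb_anti y (n + 2) * cheb_anti (- y) (n + 1)"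

lemma P_form_rec:
  "P_form y (n + 4) = - y * (P_form (- y) (n + 3) + P_form (- y) (n + 1))
     + 2 * P_form y (n + 2) - P_form y n"
proof (cases "even n")
  case True
  then show ?thesis
    using cheb_parity[of n y] cheb_parity[of n "- y"]
    by (simp add: P_form_def eval_nat_numeral) (simp add: algebra_simps)
next
  case False
  then show ?thesis
    using cheb_parity[of n y] cheb_parity[of n "- y"]
    by (simp add: P_form_def eval_nat_numeral) (simp add: algebra_simps)
qed

lemma Q_form_rec:
  "Q_form y (n + 4) = - y * (Q_form (- y) (n + 3) + Q_form (- y) (n + 1))
     + 2 * Q_form y (n + 2) - Q_form y n"
proof (cases "even n")
  case True
  then show ?thesis
    using cheb_parity[of n y] cheb_parity[of n "- y"]
    by (simp add: Q_form_def eval_nat_numeral) (simp add: algebra_simps)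
next
  case False
  then show ?thesis
    using cheb_parity[of n y] cheb_parity[of n "- y"]
    by (simp add: Q_form_def eval_nat_numeral) (simp add: algebra_simps)
qed

section \<open>Identification of \<open>P\<close> and \<open>Q\<close> with the bilinear
  forms\<close>

lemma neg_arg_cheb:
  fixes y :: "rat poly"
  shows "neg_arg (cheb_sym y n) = cheb_sym (neg_arg y) n"
    and "neg_arg (cheb_anti y n) = cheb_anti (neg_arg y) n"
  by (induction y n and y n rule: cheb_sym_cheb_anti.induct)
     (simp_all add: pcompose_1 pcompose_add pcompose_mult pcompose_smult numeral_poly)

lemma neg_arg_Y: "neg_arg Y = - Y"
  by (simp add: Y_def pcompose_pCons)

lemma neg_arg_form:
  "neg_arg (P_form Y n) = P_form (- Y) n" "neg_arg (Q_form Y n) = Q_form (- Y) n"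
  by (simp_all add: P_form_def Q_form_def pcompose_add pcompose_diff pcompose_mult pcompose_uminus
      neg_arg_cheb neg_arg_Y)

lemma neg_arg_double: "2 * neg_arg p = neg_arg (2 * p)"
  by (simp add: numeral_poly pcompose_smult)

lemma P_eq_P_form: "2 * P n = P_form Y n"
proof (induction n rule: P.induct)
  case (5 n)
  \<comment> \<open>The factor 2 is moved next to each earlier term, so that the induction
    hypotheses about \<open>2 * P\<close> apply, also under \<open>neg_arg\<close>.\<close>
  have "2 * P (n + 4) = - Y * (2 * neg_arg (P (n + 3)) + 2 * neg_arg (P (n + 1)))
      + 2 * (2 * P (n + 2)) - 2 * P n"
    by (simp add: eval_nat_numeral algebra_simps)
  also have "\<dots> = P_form Y (n + 4)"
    using 5 by (simp only: neg_arg_double neg_arg_form P_form_rec)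
  finally show ?case
    by (simp add: eval_nat_numeral)
qed (simp_all add: P_form_def eval_nat_numeral algebra_simps)

lemma Q_eq_Q_form: "2 * Q n = Q_form Y n"
proof (induction n rule: Q.induct)
  case (5 n)
  have "2 * Q (n + 4) = - Y * (2 * neg_arg (Q (n + 3)) + 2 * neg_arg (Q (n + 1)))
      + 2 * (2 * Q (n + 2)) - 2 * Q n"
    by (simp add: eval_nat_numeral algebra_simps)
  also have "\<dots> = Q_form Y (n + 4)"
    using 5 by (simp only: neg_arg_double neg_arg_form Q_form_rec)
  finally show ?case
    by (simp add: eval_nat_numeral)
qed (simp_all add: Q_form_def eval_nat_numeral algebra_simps)

lemma fps_of_poly_cheb:
  "fps_of_poly (cheb_sym y n) = cheb_sym (fps_of_poly y) n"
  "fps_of_poly (cheb_anti y n) = cheb_anti (fps_of_poly y) n"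
  by (induction y n and y n rule: cheb_sym_cheb_anti.induct)
     (simp_all add: fps_of_poly_add fps_of_poly_mult)

lemma fps_of_poly_Y: "fps_of_poly Y = fps_X"
  by (simp add: Y_def fps_of_poly_pCons)

lemma fps_of_poly_P: "2 * fps_of_poly (P n) = P_form fps_X n"
proof -
  have "2 * fps_of_poly (P n) = fps_of_poly (2 * P n)"
    by (simp add: fps_of_poly_mult)
  also have "\<dots> = P_form fps_X n"
    unfolding P_eq_P_form
    by (simp add: P_form_def fps_of_poly_add fps_of_poly_mult fps_of_poly_uminus
        fps_of_poly_cheb fps_of_poly_Y
        del: add_2_eq_Suc')
  finally show ?thesis .
qed

lemma fps_of_poly_Q: "2 * fps_of_poly (Q n) = Q_form fps_X n"
proof -
  have "2 * fps_of_poly (Q n) = fps_of_poly (2 * Q n)"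
    by (simp add: fps_of_poly_mult)
  also have "\<dots> = Q_form fps_X n"
    unfolding Q_eq_Q_form
    by (simp add: Q_form_def fps_of_poly_diff fps_of_poly_mult fps_of_poly_uminus
        fps_of_poly_cheb fps_of_poly_Y
        del: add_2_eq_Suc')
  finally show ?thesis .
qed

subsection \<open>The solution of the linear system\<close>

text \<open>The even extension to negative indices, paired with the odd one below, as suggested by
  \<open>q^n + q^(-n)\<close> and \<open>q^n - q^(-n)\<close>. The index
  \<open>s + 1 - 2 * i\<close> used in \<open>sol\<close> becomes negative in the second half of the
  vector.\<close>

definition cheb_sym_int :: "'a::comm_ring_1 \<Rightarrow> int \<Rightarrow> 'a" where
  "cheb_sym_int y n = cheb_sym y (nat \<bar>n\<bar>)"

definition cheb_anti_int :: "'a::comm_ring_1 \<Rightarrow> int \<Rightarrow> 'a" where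
  "cheb_anti_int y n = of_int (sgn n) * cheb_anti y (nat \<bar>n\<bar>)"

lemma cheb_int_of_nat [simp]:
  "cheb_sym_int y (int n) = cheb_sym y n" "cheb_anti_int y (int n) = cheb_anti y n"
  by (simp_all add: cheb_sym_int_def cheb_anti_int_def sgn_if)

lemma cheb_int_minus [simp]:
  "cheb_sym_int y (- n) = cheb_sym_int y n" "cheb_anti_int y (- n) = - cheb_anti_int y n"
  by (simp_all add: cheb_sym_int_def cheb_anti_int_def)

text \<open>Only \<open>n = 0\<close> reaches a negative index; there the initial values 0 and 2 at
  index 0 make the odd and even extensions fit the recurrence.\<close>

lemma cheb_int_rec_nat:
  "cheb_sym_int y (int n + 1) = cheb_sym_int y (int n - 1) + y * cheb_anti_int y (int n)"
  "cheb_anti_int y (int n + 1) = cheb_anti_int y (int n - 1) + cheb_sym_int y (int n)"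
proof -
  have 1: "int n + 1 = int (Suc n)" by simp
  show "cheb_sym_int y (int n + 1) = cheb_sym_int y (int n - 1) + y * cheb_anti_int y (int n)"
    unfolding 1 cheb_int_of_nat by (cases n) (simp_all add: cheb_sym_int_def)
  show "cheb_anti_int y (int n + 1) = cheb_anti_int y (int n - 1) + cheb_sym_int y (int n)"
    unfolding 1 cheb_int_of_nat by (cases n) (simp_all add: cheb_anti_int_def nat_add_distrib)
qed

lemma cheb_int_rec:
  "cheb_sym_int y (n + 1) = cheb_sym_int y (n - 1) + y * cheb_anti_int y n"
  "cheb_anti_int y (n + 1) = cheb_anti_int y (n - 1) + cheb_sym_int y n"
proof -
  have "cheb_sym_int y (n + 1) = cheb_sym_int y (n - 1) + y * cheb_anti_int y n \<and>
    cheb_anti_int y (n + 1) = cheb_anti_int y (n - 1) + cheb_sym_int y n"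
  proof (cases "n \<ge> 0")
    case True
    then show ?thesis
      using cheb_int_rec_nat[of y "nat n"] by simp
  next
    case False
    \<comment> \<open>Reflection turns the recurrence at \<open>n\<close> into the one at
      \<open>m\<close>, with its outer terms exchanged.\<close>
    define m where "m = nat (- n)"
    have "n = - int m" "n + 1 = - (int m - 1)" "n - 1 = - (int m + 1)"
      using False by (simp_all add: m_def)
    then show ?thesis
      using cheb_int_rec_nat[of y m] by (simp only: cheb_int_minus) simp
  qed
  then show "cheb_sym_int y (n + 1) = cheb_sym_int y (n - 1) + y * cheb_anti_int y n"
    "cheb_anti_int y (n + 1) = cheb_anti_int y (n - 1) + cheb_sym_int y n"
    by simp_all
qed

text \<open>The vector \<open>v\<close>: under \<open>i\<close> to \<open>s + 1 - i\<close> the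
  Chebyshev index changes sign, so the first summand is symmetric and the second antisymmetric.
  Their coefficients are matched so that the partial-sum formula below vanishes at
  \<open>k = 0\<close>.\<close>

definition sol :: "'a::comm_ring_1 \<Rightarrow> nat \<Rightarrow> nat \<Rightarrow> 'a" where
  "sol y s i =
     cheb_sym (- y) (s + 2) * cheb_sym_int y (int s + 1 - 2 * int i)
     + y * cheb_anti y (s + 2) * cheb_anti_int (- y) (int s + 1 - 2 * int i)"

text \<open>The sum telescopes: by \<open>cheb_int_rec\<close>, each Chebyshev factor of
  \<open>sol\<close> is a difference of values at the two neighbouring indices.\<close>

lemma sol_partial_sum:
  "(\<Sum>j<k. sol y s j) =
     cheb_anti y (s + 2) * cheb_sym_int (- y) (int s + 2 - 2 * int k)
     - cheb_sym (- y) (s + 2) * cheb_anti_int y (int s + 2 - 2 * int k)"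
proof (induction k)
  case 0
  have "int s + 2 - 2 * int 0 = int (s + 2)" by simp
  then show ?case
    by (simp only: cheb_int_of_nat) simp
next
  case (Suc k)
  have eqs: "cheb_anti_int y (int s + 2 - 2 * int k)
      = cheb_anti_int y (int s - 2 * int k) + cheb_sym_int y (int s + 1 - 2 * int k)"
    "cheb_sym_int (- y) (int s + 2 - 2 * int k)
      = cheb_sym_int (- y) (int s - 2 * int k) - y * cheb_anti_int (- y) (int s + 1 - 2 * int k)"
    using cheb_int_rec[of y "int s + 1 - 2 * int k"] cheb_int_rec[of "- y" "int s + 1 - 2 * int k"]
    by (simp_all add: algebra_simps)
  have shift: "int s + 2 - 2 * int (Suc k) = int s - 2 * int k"
    by simp
  show ?case
    unfolding sum.lessThan_Suc Suc unfolding sol_def shift eqs by (simp add: algebra_simps del: add_2_eq_Suc')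
qed

lemma sol_sum: "(\<Sum>j\<le>s. sol y s j) = P_form y s"
proof -
  \<comment> \<open>The full sum ends at index \<open>- s\<close>, where oddness of
    \<open>cheb_anti_int\<close> turns the difference into the sum in \<open>P_form\<close>.\<close>
  have "int s + 2 - 2 * int (Suc s) = - int s" by simp
  then show ?thesis
    unfolding lessThan_Suc_atMost[symmetric] sol_partial_sum P_form_def
    by (simp only: cheb_int_minus cheb_int_of_nat) simp
qed

text \<open>This is the difference of two consecutive equations of the system: rows
  \<open>s - k\<close> and \<open>s + 1 - k\<close> of the matrix differ by 1 exactly in the columns
  \<open>j \<le> k\<close>.\<close>

lemma sol_diff:
  assumes "k \<le> s"
  shows "sol y s (s - k) = sol y s (Suc s - k) + y * (\<Sum>j\<le>k. sol y s j)"
proof -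
  define c where "c = int s - 2 * int k"
  have eqs: "int s + 1 - 2 * int (s - k) = - (c - 1)" "int s + 1 - 2 * int (Suc s - k) = - (c + 1)"
    "int s + 2 - 2 * int (Suc k) = c"
    using assms by (simp_all add: c_def of_nat_diff)
  have sum: "(\<Sum>j\<le>k. sol y s j) =
      cheb_anti y (s + 2) * cheb_sym_int (- y) c - cheb_sym (- y) (s + 2) * cheb_anti_int y c"
    unfolding lessThan_Suc_atMost[symmetric] sol_partial_sum eqs ..
  show ?thesis
    unfolding sum unfolding sol_def eqs cheb_int_minus
    using cheb_int_rec[of y c] cheb_int_rec[of "- y" c]
    by (simp add: algebra_simps)
qed

text \<open>The first differences are summed upwards from row \<open>s + 1\<close>, just outside the
  matrix. That row is zero, and \<open>sol\<close> there equals \<open>Q_form\<close>.\<close>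

lemma sol_system_rev:
  "k \<le> Suc s \<Longrightarrow> sol y s (Suc s - k) = Q_form y s + y * (\<Sum>j<k. of_nat (k - j) * sol y s j)"
proof (induction k)
  case 0
  have "int s + 1 - 2 * int (Suc s) = - int (Suc s)" by simp
  then show ?case
    unfolding sol_def Q_form_def diff_zero by (simp only: cheb_int_minus cheb_int_of_nat) simp
next
  case (Suc k)
  have "(\<Sum>j<k. of_nat (Suc k - j) * sol y s j)
      = (\<Sum>j<k. of_nat (k - j) * sol y s j) + (\<Sum>j<k. sol y s j)"
    unfolding sum.distrib[symmetric]
    by (intro sum.cong) (auto simp: Suc_diff_le algebra_simps)
  then have "(\<Sum>j<Suc k. of_nat (Suc k - j) * sol y s j)
      = (\<Sum>j<k. of_nat (k - j) * sol y s j) + (\<Sum>j\<le>k. sol y s j)"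
    by (simp add: lessThan_Suc_atMost[symmetric] add.assoc)
  then show ?case
    using Suc sol_diff[of k s y] by (simp add: algebra_simps)
qed

lemma sol_system:
  assumes "i \<le> s"
  shows "sol y s i = Q_form y s + y * (\<Sum>j\<le>s. of_nat (s + 1 - (i + j)) * sol y s j)"
proof -
  \<comment> \<open>Truncated subtraction supplies the maximum with 0 in the matrix entries, so
    columns from \<open>s + 1 - i\<close> on contribute nothing.\<close>
  have "(\<Sum>j\<le>s. of_nat (s + 1 - (i + j)) * sol y s j)
      = (\<Sum>j<Suc s - i. of_nat (s + 1 - (i + j)) * sol y s j)"
  proof (rule sum.mono_neutral_right)
    show "\<forall>j\<in>{..s} - {..<Suc s - i}. of_nat (s + 1 - (i + j)) * sol y s j = 0"
    proof
      fix j assume "j \<in> {..s} - {..<Suc s - i}"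
      then have "s + 1 - (i + j) = 0" by auto
      then show "of_nat (s + 1 - (i + j)) * sol y s j = 0" by (simp only: of_nat_0 mult_zero_left)
    qed
  qed auto
  also have "\<dots> = (\<Sum>j<Suc s - i. of_nat (Suc s - i - j) * sol y s j)"
    by simp
  finally show ?thesis
    using sol_system_rev[of "Suc s - i" s y] assms by simp
qed

subsection \<open>Counting labellings with the transfer matrix\<close>

text \<open>The label of the last dangling edge is the state of the transfer matrix.\<close>

definition labellings_ending :: "nat \<Rightarrow> nat \<Rightarrow> nat \<Rightarrow> ((nat \<Rightarrow> nat) \<times> (nat \<times> nat \<Rightarrow> nat)) set" where
  "labellings_ending n s i = {(\<beta>, \<alpha>) \<in> magic_labellings n s. \<beta> (n + 1) = i}"

text \<open>With no vertex there is a single unconstrained edge. The resulting all-ones start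
  vector, summed over \<open>i \<le> s\<close>, reproduces the convention
  \<open>h_L2 0 s = s + 1\<close>.\<close>

lemma labellings_ending_0:
  "labellings_ending 0 s i = {(\<lambda>k. if k = 1 then i else undefined, \<lambda>_. undefined)}"
proof -
  have "\<beta> \<in> {1} \<rightarrow>\<^sub>E UNIV \<and> \<beta> 1 = i \<longleftrightarrow> \<beta> = (\<lambda>k. if k = 1 then i else undefined)"
    for \<beta> :: "nat \<Rightarrow> nat"
  proof
    assume *: "\<beta> \<in> {1} \<rightarrow>\<^sub>E UNIV \<and> \<beta> 1 = i"
    show "\<beta> = (\<lambda>k. if k = 1 then i else undefined)"
    proof
      fix k show "\<beta> k = (if k = 1 then i else undefined)"
        using * PiE_arb[of \<beta> "{1}" _ k] by auto
    qed
  qed (auto simp: PiE_iff extensional_def)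
  moreover have "labellings_ending 0 s i =
      {\<beta>. \<beta> \<in> {1} \<rightarrow>\<^sub>E UNIV \<and> \<beta> 1 = i} \<times> {\<lambda>_. undefined}"
    by (auto simp: labellings_ending_def magic_labellings_def simp del: PiE_singleton)
  ultimately show ?thesis
    by simp
qed

lemma finite_labellings_ending: "finite (labellings_ending n s i)"
proof (cases "n = 0")
  case False
  then show ?thesis
    by (intro finite_subset[OF _ finite_magic_labellings[of n s]])
       (auto simp: labellings_ending_def)
qed (simp add: labellings_ending_0)

lemma card_loop_pairs: "card {(a, b). t + a + b = s} = Suc s - t" for s t :: nat
proof -
  have "{(a, b). t + a + b = s} = (\<lambda>a. (a, s - t - a)) ` {..<Suc s - t}"
    by (auto simp: image_iff)
  also have "card \<dots> = Suc s - t"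
    by (subst card_image) (auto simp: inj_on_def)
  finally show ?thesis .
qed

lemma finite_loop_pairs: "finite {(a, b). t + a + b = s}" for s t :: nat
  by (rule finite_subset[of _ "{..s} \<times> {..s}"]) auto

text \<open>A new vertex turns the old end edge, labelled \<open>i\<close>, into an inner edge; its
  two loops must sum to \<open>s - i - j\<close>, which \<open>card_loop_pairs\<close>
  counts.\<close>

lemma card_labellings_ending_Suc:
  "card (labellings_ending (Suc n) s j)
     = (\<Sum>i\<le>s. card (labellings_ending n s i) * (s + 1 - (i + j)))"
proof -
  define D where
    "D = (SIGMA i:{..s}. labellings_ending n s i \<times> {(a, b). i + j + a + b = s})"
  define f :: "nat \<times> ((nat \<Rightarrow> nat) \<times> (nat \<times> nat \<Rightarrow> nat)) \<times> nat \<times> nat \<Rightarrow>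
      (nat \<Rightarrow> nat) \<times> (nat \<times> nat \<Rightarrow> nat)" where
    "f = (\<lambda>(i, (\<beta>, \<alpha>), (a, b)).
       (\<beta>(n + 2 := j), \<alpha>((n + 1, 1) := a, (n + 1, 2) := b)))"
  \<comment> \<open>The inverse removes the last vertex; \<open>restrict\<close> resets the lost
    edges to \<open>undefined\<close>, as the extensional function spaces require.\<close>
  define g :: "(nat \<Rightarrow> nat) \<times> (nat \<times> nat \<Rightarrow> nat) \<Rightarrow>
      nat \<times> ((nat \<Rightarrow> nat) \<times> (nat \<times> nat \<Rightarrow> nat)) \<times> nat \<times> nat" where
    "g = (\<lambda>(\<beta>, \<alpha>). (\<beta> (n + 1),
       (restrict \<beta> {1..n + 1}, restrict \<alpha> ({1..n} \<times> {1, 2})), (\<alpha> (n + 1, 1), \<alpha> (n + 1, 2))))"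
  have "bij_betw f D (labellings_ending (Suc n) s j)"
  proof (rule bij_betw_byWitness[where f' = g])
    show "\<forall>x\<in>D. g (f x) = x"
      by (auto simp: D_def f_def g_def labellings_ending_def magic_labellings_def
          PiE_iff extensional_def fun_eq_iff)
    show "\<forall>x\<in>labellings_ending (Suc n) s j. f (g x) = x"
    proof
      fix x assume x: "x \<in> labellings_ending (Suc n) s j"
      obtain \<beta> \<alpha> where [simp]: "x = (\<beta>, \<alpha>)" by force
      have "\<beta> \<in> {1..n + 2} \<rightarrow>\<^sub>E UNIV" "\<alpha> \<in> {1..n + 1} \<times> {1, 2} \<rightarrow>\<^sub>E UNIV" and j: "\<beta> (n + 2) = j"
        using x by (auto simp: labellings_ending_def magic_labellings_def)
      note out = this(1,2)[THEN PiE_arb]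
      have "((restrict \<beta> {1..n + 1})(n + 2 := j)) k = \<beta> k" for k
        using out(1)[of k] j by (cases "k = n + 2") (auto simp: restrict_def)
      moreover have "((restrict \<alpha> ({1..n} \<times> {1, 2}))((n + 1, 1) := \<alpha> (n + 1, 1),
          (n + 1, 2) := \<alpha> (n + 1, 2))) p = \<alpha> p" for p
        using out(2)[of p] by (cases p) (auto simp: restrict_def le_Suc_eq)
      ultimately show "f (g x) = x"
        by (simp add: f_def g_def fun_eq_iff del: fun_upd_apply)
    qed
    show "f ` D \<subseteq> labellings_ending (Suc n) s j"
    proof (rule image_subsetI)
      fix x assume x: "x \<in> D"
      obtain i \<beta> \<alpha> a b where [simp]: "x = (i, (\<beta>, \<alpha>), (a, b))" by (metis surj_pair)
      have "\<beta> \<in> {1..n + 1} \<rightarrow>\<^sub>E UNIV" "\<alpha> \<in> {1..n} \<times> {1, 2} \<rightarrow>\<^sub>E UNIV"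
        and eq: "\<And>k. k \<in> {1..n} \<Longrightarrow> \<beta> k + \<alpha> (k, 1) + \<alpha> (k, 2) + \<beta> (k + 1) = s"
        and last: "\<beta> (n + 1) = i" "i + j + a + b = s"
        using x by (auto simp: D_def labellings_ending_def magic_labellings_def)
      let ?\<beta> = "\<beta>(n + 2 := j)" and ?\<alpha> = "\<alpha>((n + 1, 1) := a, (n + 1, 2) := b)"
      have "?\<beta> \<in> {1..Suc n + 1} \<rightarrow>\<^sub>E UNIV" "?\<alpha> \<in> {1..Suc n} \<times> {1, 2} \<rightarrow>\<^sub>E UNIV"
        using \<open>\<beta> \<in> _\<close> \<open>\<alpha> \<in> _\<close> by (auto simp: PiE_iff extensional_def)
      moreover have "?\<beta> k + ?\<alpha> (k, 1) + ?\<alpha> (k, 2) + ?\<beta> (k + 1) = s" if "k \<in> {1..Suc n}" for k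
        using eq[of k] last that by (cases "k = Suc n") auto
      ultimately show "f x \<in> labellings_ending (Suc n) s j"
        by (simp add: f_def labellings_ending_def magic_labellings_def del: fun_upd_apply)
           (simp add: fun_upd_apply)
    qed
    show "g ` labellings_ending (Suc n) s j \<subseteq> D"
    proof (rule image_subsetI)
      fix x assume x: "x \<in> labellings_ending (Suc n) s j"
      obtain \<beta> \<alpha> where [simp]: "x = (\<beta>, \<alpha>)" by force
      have eq: "\<And>k. k \<in> {1..Suc n} \<Longrightarrow> \<beta> k + \<alpha> (k, 1) + \<alpha> (k, 2) + \<beta> (k + 1) = s"
        and "\<beta> (n + 2) = j"
        using x by (auto simp: labellings_ending_def magic_labellings_def)
      then have "\<beta> (n + 1) + j + \<alpha> (n + 1, 1) + \<alpha> (n + 1, 2) = s"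
        using eq[of "n + 1"] by simp
      moreover have "(restrict \<beta> {1..n + 1}, restrict \<alpha> ({1..n} \<times> {1, 2}))
          \<in> labellings_ending n s (\<beta> (n + 1))"
        using eq by (auto simp: labellings_ending_def magic_labellings_def)
      ultimately show "g x \<in> D"
        by (simp add: D_def g_def)
    qed
  qed
  then have "card (labellings_ending (Suc n) s j) = card D"
    by (simp add: bij_betw_same_card)
  also have "\<dots> = (\<Sum>i\<le>s. card (labellings_ending n s i) * (s + 1 - (i + j)))"
    unfolding D_def
    by (subst card_SigmaI)
       (auto simp: finite_labellings_ending finite_loop_pairs card_loop_pairs card_cartesian_product)
  finally show ?thesis .
qed

lemma h_L2_eq_sum: "h_L2 n s = (\<Sum>i\<le>s. card (labellings_ending n s i))"
proof (cases "n = 0")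
  case False
  have "magic_labellings n s = (\<Union>i\<in>{..s}. labellings_ending n s i)"
  proof (rule subset_antisym)
    show "magic_labellings n s \<subseteq> (\<Union>i\<in>{..s}. labellings_ending n s i)"
    proof
      fix x assume x: "x \<in> magic_labellings n s"
      obtain \<beta> \<alpha> where x_eq: "x = (\<beta>, \<alpha>)" by (cases x)
      have "\<beta> n + \<alpha> (n, 1) + \<alpha> (n, 2) + \<beta> (n + 1) = s"
        using x False by (simp add: x_eq magic_labellings_def)
      then have "\<beta> (n + 1) \<le> s" by simp
      then show "x \<in> (\<Union>i\<in>{..s}. labellings_ending n s i)"
        using x by (simp add: x_eq labellings_ending_def)
    qed
  qed (auto simp: labellings_ending_def)
  also have "card \<dots> = (\<Sum>i\<le>s. card (labellings_ending n s i))"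
    by (rule card_UN_disjoint)
       (simp_all add: finite_labellings_ending, auto simp: labellings_ending_def)
  finally show ?thesis
    using False by (simp add: h_L2_def)
qed (simp add: h_L2_def labellings_ending_0)

section \<open>Generating functions and the quotient formula\<close>

definition ending_series :: "nat \<Rightarrow> nat \<Rightarrow> rat fps" where
  "ending_series s i = Abs_fps (\<lambda>n. of_nat (card (labellings_ending n s i)))"

lemma ending_series_rec:
  "ending_series s j = 1 + fps_X * (\<Sum>i\<le>s. of_nat (s + 1 - (i + j)) * ending_series s i)"
proof (rule fps_ext)
  fix n
  show "fps_nth (ending_series s j) n =
      fps_nth (1 + fps_X * (\<Sum>i\<le>s. of_nat (s + 1 - (i + j)) * ending_series s i)) n"
    by (cases n) (simp_all add: ending_series_def labellings_ending_0 card_labellings_ending_Suc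
        fps_sum_nth fps_of_nat[symmetric] mult.commute)
qed

lemma FL2_eq_sum: "FL2 s = (\<Sum>i\<le>s. ending_series s i)"
  by (rule fps_ext) (simp add: FL2_def ending_series_def h_L2_eq_sum fps_sum_nth)

text \<open>The pairing of \<open>F\<close> with \<open>(I - y M) v\<close> is evaluated twice: the
  system for \<open>v\<close> gives the left side, and moving the matrix onto \<open>F\<close>
  leaves the sum of the entries of \<open>v\<close>. No matrix inverse has to be formed.\<close>

lemma FL2_mult_Q: "FL2 s * Q_form fps_X s = P_form fps_X s"
proof -
  let ?F = "ending_series s" and ?v = "sol (fps_X :: rat fps) s"
  let ?M = "\<lambda>i j. of_nat (s + 1 - (i + j)) :: rat fps"
  have "FL2 s * Q_form fps_X s = (\<Sum>i\<le>s. ?F i * (?v i - fps_X * (\<Sum>j\<le>s. ?M i j * ?v j)))"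
    unfolding FL2_eq_sum sum_distrib_right
    by (intro sum.cong refl arg_cong2[where f = "(*)"]) (simp add: sol_system[of _ s fps_X])
  also have "\<dots> = (\<Sum>i\<le>s. ?F i * ?v i) - (\<Sum>i\<le>s. \<Sum>j\<le>s. fps_X * ?M i j * ?F i * ?v j)"
    by (simp only: right_diff_distrib sum_subtractf sum_distrib_left) (simp only: mult_ac)
  \<comment> \<open>Exchanging the sums moves the matrix from \<open>?v\<close> to
    \<open>?F\<close>, where \<open>ending_series_rec\<close> evaluates it.\<close>
  also have "(\<Sum>i\<le>s. \<Sum>j\<le>s. fps_X * ?M i j * ?F i * ?v j)
      = (\<Sum>j\<le>s. (fps_X * (\<Sum>i\<le>s. ?M i j * ?F i)) * ?v j)"
    by (subst sum.swap) (simp only: sum_distrib_left sum_distrib_right mult_ac)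
  also have "\<dots> = (\<Sum>j\<le>s. (?F j - 1) * ?v j)"
    using ending_series_rec[of s] by (metis (no_types, lifting) add_diff_cancel_left')
  also have "(\<Sum>i\<le>s. ?F i * ?v i) - \<dots> = P_form fps_X s"
    by (simp add: sum_subtractf[symmetric] left_diff_distrib sol_sum)
  finally show ?thesis .
qed

theorem theorem1p3:
  fixes s :: nat
  assumes "s \<ge> 1"
  shows "FL2 s = fps_of_poly (P s) / fps_of_poly (Q s)"
proof -
  have "2 * (FL2 s * fps_of_poly (Q s)) = 2 * fps_of_poly (P s)"
    using FL2_mult_Q[of s] by (simp add: fps_of_poly_P fps_of_poly_Q[symmetric] mult_ac)
  then have "FL2 s * fps_of_poly (Q s) = fps_of_poly (P s)"
    by simp
  moreover have "fps_of_poly (Q s) \<noteq> 0"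
    using coeff_0_Q[of s] by auto
  ultimately show ?thesis
    by (metis nonzero_mult_div_cancel_right)
qed

end
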